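(* Let $A\in\mathbb{R}^{n\times n}$ be nonsingular, $B\in\mathbb{R}^{n\times k}$, $C\in\mathbb{R}^{k\times n}$, let $T>0$, and suppose that the $k\times k$ matrix $CA^{-1}(e^{AT}-I_n)B$ is nonsingular. Let $\Psi_T=\big(CA^{-1}(e^{AT}-I_n)B\big)^{-1}$ and $$\Phi_T=\begin{pmatrix}A & B\\ -\Psi_T\,Ce^{AT} & -I_k\end{pmatrix}\in\mathbb{R}^{(n+k)\times(n+k)}.$$ Let $r\in\mathbb{R}^k$ be a constant, and let $x:[0,\infty)\to\mathbb{R}^n$, $u:[0,\infty)\to\mathbb{R}^k$ be a solution (with arbitrary initial conditions) of the closed-loop system $$\begin{pmatrix}\dot x(t)\\ \dot u(t)\end{pmatrix}=\Phi_T\begin{pmatrix}x(t)\\ u(t)\end{pmatrix}+\begin{pmatrix}0\\ \Psi_T\end{pmatrix}r,\qquad t\ge 0,$$ with output $y(t)=Cx(t)$. Suppose that $\Phi_T$ is Hurwitz. Then $$\lim_{t\to\infty}y(t)=r.$$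
   Context: A real square matrix is Hurwitz if all of its eigenvalues have strictly negative real part. $I_m$ denotes the $m\times m$ identity matrix. The closed-loop system consists of the linear time-invariant plant $\dot x=Ax+Bu$, $y=Cx$, together with the controller $\dot u(t)=\Psi_T\big(r-Ce^{AT}x(t)\big)-u(t)$, where $r$ is the constant reference to be tracked. *)

theory Defs
  imports "HOL-Analysis.Analysis"
begin

text \<open>
  The library's ring structure on \<open>'a ^ 'n\<close> is componentwise, so neither
  \<^term>\<open>(^)\<close> nor \<^term>\<open>exp\<close> gives the matrix power or the matrix exponential on
  \<open>real ^ 'n ^ 'n\<close>; both are defined here from the matrix product.
\<close>

primrec matrix_power :: "'a::semiring_1 ^ 'n ^ 'n \<Rightarrow> nat \<Rightarrow> 'a ^ 'n ^ 'n" where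
  "matrix_power M 0 = mat 1"
| "matrix_power M (Suc j) = M ** matrix_power M j"

definition matrix_exp :: "real ^ 'n ^ 'n \<Rightarrow> real ^ 'n ^ 'n" where
  "matrix_exp M = (\<Sum>j. (1 / fact j) *\<^sub>R matrix_power M j)"

definition complex_eigenvalue :: "real ^ 'n ^ 'n \<Rightarrow> complex \<Rightarrow> bool" where
  "complex_eigenvalue M z \<longleftrightarrow>
     (\<exists>v :: complex ^ 'n. v \<noteq> 0 \<and> map_matrix complex_of_real M *v v = z *s v)"

definition hurwitz :: "real ^ 'n ^ 'n \<Rightarrow> bool" where
  "hurwitz M \<longleftrightarrow> (\<forall>z. complex_eigenvalue M z \<longrightarrow> Re z < 0)"

text \<open>
  Stacking is polymorphic in the entries: for real entries it stacks two column
  vectors, for row vectors as entries it stacks two matrices with equally many columns.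
\<close>

definition stack :: "'a ^ 'm \<Rightarrow> 'a ^ 'p \<Rightarrow> 'a ^ ('m + 'p)" where
  "stack v w = (\<chi> i. case i of Inl a \<Rightarrow> v $ a | Inr b \<Rightarrow> w $ b)"

definition beside :: "'a ^ 'm ^ 'q \<Rightarrow> 'a ^ 'p ^ 'q \<Rightarrow> 'a ^ ('m + 'p) ^ 'q" where
  "beside P Q = (\<chi> i. stack (P $ i) (Q $ i))"

definition block_matrix ::
    "'a ^ 'm ^ 'q \<Rightarrow> 'a ^ 'p ^ 'q \<Rightarrow> 'a ^ 'm ^ 's \<Rightarrow> 'a ^ 'p ^ 's \<Rightarrow> 'a ^ ('m + 'p) ^ ('q + 's)" where
  "block_matrix P Q R S = stack (beside P Q) (beside R S)"

definition Psi ::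
    "real ^ 'n ^ 'n \<Rightarrow> real ^ 'k ^ 'n \<Rightarrow> real ^ 'n ^ 'k \<Rightarrow> real \<Rightarrow> real ^ 'k ^ 'k" where
  "Psi A B C T =
     matrix_inv (C ** matrix_inv A ** (matrix_exp (T *\<^sub>R A) - mat 1) ** B)"

definition Phi ::
    "real ^ 'n ^ 'n \<Rightarrow> real ^ 'k ^ 'n \<Rightarrow> real ^ 'n ^ 'k \<Rightarrow> real \<Rightarrow> real ^ ('n + 'k) ^ ('n + 'k)" where
  "Phi A B C T =
     block_matrix A B (- (Psi A B C T ** C ** matrix_exp (T *\<^sub>R A))) (- mat 1)"

end

theory Submission
  imports Defs "HOL-Computational_Algebra.Fundamental_Theorem_Algebra"
begin

text \<open>
  A Hurwitz matrix \<open>\<Phi>\<close> is invertible, so the closed loop has an equilibrium \<open>(x*, u*)\<close>. Write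
  \<open>E = e\<^sup>A\<^sup>T\<close>. The plant equation gives \<open>A\<inverse> B u* = - x*\<close>, and the controller equation
  multiplied by \<open>\<Psi>\<inverse> = C A\<inverse> (E - I) B\<close> gives \<open>C A\<inverse> (E - I) B u* = r - C E x*\<close>. Since \<open>E\<close>
  commutes with \<open>A\<inverse>\<close>, the left-hand side is \<open>C (E - I) A\<inverse> B u* = C x* - C E x*\<close>, whence
  \<open>C x* = r\<close>: the gain \<open>\<Psi>\<close> is chosen so that the steady-state output is the reference
  (\<open>closed_loop_equilibrium_output\<close>).

  It remains to see that the error \<open>e\<close>, the difference between the state and the equilibrium, tends to \<open>0\<close>.
  It solves \<open>e' = \<Phi> e\<close>, so this is the asymptotic stability of a Hurwitz system
  (\<open>hurwitz_solution_tendsto_0\<close>). Over the complex numbers some nonzero polynomial annihilates \<open>\<Phi>\<close>,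
  because its powers are linearly dependent, and the polynomial splits into linear factors. Remove
  the factors one at a time: if \<open>(\<Phi> - \<lambda>) q(\<Phi>)\<close> kills a solution \<open>w\<close>, then \<open>g = (\<Phi> - \<lambda>) w\<close> is
  a solution killed by \<open>q(\<Phi>)\<close>, so \<open>g\<close> tends to \<open>0\<close> by induction. If \<open>\<lambda>\<close> is an eigenvalue, then
  \<open>w' = \<lambda> w + g\<close> with \<open>Re \<lambda> < 0\<close> and an energy estimate shows that \<open>w\<close> tends to \<open>0\<close>
  (\<open>forced_decay_tendsto_0\<close>); otherwise \<open>\<Phi> - \<lambda>\<close> is invertible and \<open>w\<close> is a fixed linear image
  of \<open>g\<close> (\<open>annihilated_solution_tendsto_0\<close>).
\<close>

section \<open>The matrix exponential commutes with its argument\<close>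

lemma matrix_add_rdistrib: "(P + Q) ** R = P ** R + Q ** R"
  by (simp add: matrix_matrix_mult_def vec_eq_iff distrib_right sum.distrib)

lemma bounded_bilinear_matrix_mult:
  "bounded_bilinear (\<lambda>(P :: real ^ 'm ^ 'q) (Q :: real ^ 'p ^ 'm). P ** Q)"
  unfolding bilinear_conv_bounded_bilinear[symmetric] bilinear_def
  by (auto intro!: linearI simp: matrix_add_ldistrib matrix_add_rdistrib scalar_matrix_assoc matrix_scalar_ac)

text \<open>
  The matrix product is bounded for the Euclidean norm of the entries up to some constant \<open>K\<close>, so
  the exponential series is dominated by the scalar series of \<open>exp (norm M * K)\<close>. Convergence is what
  allows linear maps to be taken inside the series.
\<close>

lemma summable_matrix_exp:
  fixes M :: "real ^ 'n ^ 'n"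
  shows "summable (\<lambda>j. (1 / fact j) *\<^sub>R matrix_power M j)"
proof -
  interpret bounded_bilinear "\<lambda>(P :: real ^ 'n ^ 'n) (Q :: real ^ 'n ^ 'n). P ** Q"
    by (rule bounded_bilinear_matrix_mult)
  obtain K where K: "K \<ge> 0" "\<And>(P :: real ^ 'n ^ 'n) (Q :: real ^ 'n ^ 'n). norm (P ** Q) \<le> norm P * norm Q * K"
    using nonneg_bounded by blast
  have bound: "norm (matrix_power M j) \<le> norm (mat 1 :: real ^ 'n ^ 'n) * (norm M * K) ^ j" for j
  proof (induction j)
    case (Suc j)
    have "norm (matrix_power M (Suc j)) \<le> (norm M * K) * norm (matrix_power M j)"
      using K(2)[of M "matrix_power M j"] by (simp add: mult_ac)
    also have "\<dots> \<le> (norm M * K) * (norm (mat 1 :: real ^ 'n ^ 'n) * (norm M * K) ^ j)"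
      using Suc K(1) by (intro mult_left_mono) auto
    finally show ?case by (simp add: mult_ac)
  qed simp
  show ?thesis
  proof (rule summable_comparison_test')
    show "summable (\<lambda>j. norm (mat 1 :: real ^ 'n ^ 'n) * (inverse (fact j) * (norm M * K) ^ j))"
      by (intro summable_mult summable_exp)
    show "norm ((1 / fact j) *\<^sub>R matrix_power M j)
        \<le> norm (mat 1 :: real ^ 'n ^ 'n) * (inverse (fact j) * (norm M * K) ^ j)" if "j \<ge> 0" for j
      using mult_left_mono[OF bound[of j], of "inverse (fact j)"] by (simp add: field_simps)
  qed
qed

lemma matrix_exp_commute:
  fixes A M :: "real ^ 'n ^ 'n"
  assumes "A ** M = M ** A"
  shows "A ** matrix_exp M = matrix_exp M ** A"
proof -
  interpret bounded_bilinear "\<lambda>(P :: real ^ 'n ^ 'n) (Q :: real ^ 'n ^ 'n). P ** Q"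
    by (rule bounded_bilinear_matrix_mult)
  have pow: "A ** matrix_power M j = matrix_power M j ** A" for j
  proof (induction j)
    case (Suc j)
    then show ?case
      using assms by (metis matrix_mul_assoc matrix_power.simps(2))
  qed simp
  have "A ** matrix_exp M = (\<Sum>j. A ** ((1 / fact j) *\<^sub>R matrix_power M j))"
    unfolding matrix_exp_def
    by (rule bounded_linear.suminf[OF bounded_linear_right summable_matrix_exp])
  also have "\<dots> = (\<Sum>j. ((1 / fact j) *\<^sub>R matrix_power M j) ** A)"
    by (simp add: matrix_scalar_ac scalar_matrix_assoc[symmetric] pow)
  also have "\<dots> = matrix_exp M ** A"
    unfolding matrix_exp_def
    by (rule bounded_linear.suminf[OF bounded_linear_left summable_matrix_exp, symmetric])
  finally show ?thesis .
qed

lemma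
  fixes A :: "real ^ 'n ^ 'n"
  assumes "invertible A"
  shows matrix_inv_right: "A ** matrix_inv A = mat 1" and matrix_inv_left: "matrix_inv A ** A = mat 1"
  using someI_ex[OF assms[unfolded invertible_def]] by (simp_all add: matrix_inv_def)

lemma matrix_inv_commute:
  fixes A E :: "real ^ 'n ^ 'n"
  assumes "invertible A" "A ** E = E ** A"
  shows "matrix_inv A ** E = E ** matrix_inv A"
  by (metis assms matrix_inv_left matrix_inv_right matrix_mul_assoc matrix_mul_lid matrix_mul_rid)

section \<open>Polynomials in a square matrix\<close>

text \<open>
  Evaluation at \<open>M\<close> by Horner's scheme, so that induction on \<open>pCons\<close> applies directly.
\<close>

definition matrix_poly :: "complex poly \<Rightarrow> complex ^ 'n ^ 'n \<Rightarrow> complex ^ 'n ^ 'n" where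
  "matrix_poly p M = fold_coeffs (\<lambda>a P. mat a + M ** P) p 0"

lemma matrix_poly_0 [simp]: "matrix_poly 0 M = 0"
  by (simp add: matrix_poly_def)

lemma matrix_poly_pCons [simp]: "matrix_poly (pCons a p) M = mat a + M ** matrix_poly p M"
  by (cases "p = 0 \<and> a = 0") (auto simp: matrix_poly_def)

lemma mat_add: "mat (a + b) = mat a + (mat b :: 'a::monoid_add ^ 'n ^ 'n)"
  by (vector mat_def)

lemma mat_matrix_mult: "mat c ** P = (\<chi> i j. c * P $ i $ j)" for P :: "'a::semiring_1 ^ 'm ^ 'n"
  by (simp add: matrix_matrix_mult_def mat_def vec_eq_iff if_distrib if_distribR cong: if_cong)

lemma mat_matrix_mult_mat: "mat (c * d) = mat c ** (mat d :: 'a::semiring_1 ^ 'n ^ 'n)"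
  by (simp add: mat_matrix_mult) (simp add: mat_def vec_eq_iff)

lemma matrix_mult_mat: "M ** (mat c ** P) = mat c ** (M ** P)"
  for M :: "'a::comm_semiring_1 ^ 'm ^ 'n"
  by (simp add: mat_matrix_mult) (simp add: matrix_matrix_mult_def vec_eq_iff sum_distrib_left mult_ac)

lemma mat_vector_mult: "mat c *v v = c *s v" for v :: "'a::semiring_1 ^ 'n"
  by (simp add: matrix_vector_mult_def mat_def vec_eq_iff if_distrib if_distribR cong: if_cong)

lemma matrix_poly_add: "matrix_poly (p + q) M = matrix_poly p M + matrix_poly q M"
  by (induction p q rule: poly_induct2) (simp_all add: mat_add matrix_add_ldistrib algebra_simps)

lemma matrix_poly_smult: "matrix_poly (smult c p) M = mat c ** matrix_poly p M"
  by (induction p) (simp_all add: matrix_add_ldistrib mat_matrix_mult_mat matrix_mult_mat)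

lemma matrix_poly_mult: "matrix_poly (p * q) M = matrix_poly p M ** matrix_poly q M"
  by (induction p)
    (simp_all add: matrix_poly_add matrix_poly_smult matrix_add_rdistrib matrix_mul_assoc)

lemma matrix_poly_monom: "matrix_poly (monom c i) M = mat c ** matrix_power M i"
  by (induction i) (simp_all add: monom_0 monom_Suc matrix_mult_mat)

lemma matrix_poly_sum: "matrix_poly (\<Sum>i\<in>I. f i) M = (\<Sum>i\<in>I. matrix_poly (f i) M)"
  by (induction I rule: infinite_finite_induct) (simp_all add: matrix_poly_add)

text \<open>
  The space of matrices has finite dimension \<open>N\<close> over the reals, so the \<open>N + 1\<close> powers
  \<open>M\<^sup>0, \<dots>, M\<^sup>N\<close> satisfy a linear relation; its coefficients are those of the polynomial.
\<close>

lemma exists_annihilating_poly: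
  fixes M :: "complex ^ 'n ^ 'n"
  obtains p where "p \<noteq> 0" "matrix_poly p M = 0"
proof -
  define N where "N = DIM(complex ^ 'n ^ 'n)"
  have "\<exists>c :: nat \<Rightarrow> real. (\<exists>i\<le>N. c i \<noteq> 0) \<and> (\<Sum>i\<le>N. c i *\<^sub>R matrix_power M i) = 0"
  proof (cases "inj_on (matrix_power M) {..N}")
    case True
    then have "card (matrix_power M ` {..N}) = Suc N"
      by (simp add: card_image)
    then have "dependent (matrix_power M ` {..N})"
      by (intro dependent_biggerset) (auto simp: N_def)
    then obtain u where u: "\<exists>P \<in> matrix_power M ` {..N}. u P \<noteq> 0"
        "(\<Sum>P \<in> matrix_power M ` {..N}. u P *\<^sub>R P) = 0"
      using real_vector.dependent_finite[of "matrix_power M ` {..N}"] by auto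
    then show ?thesis
      using True by (intro exI[of _ "u \<circ> matrix_power M"]) (auto simp: sum.reindex)
  next
    case False
    \<comment> \<open>A repeated power makes the set of powers too small for the dimension count, but is itself
      a linear relation.\<close>
    then obtain i j where ij: "i \<le> N" "j \<le> N" "i \<noteq> j" "matrix_power M i = matrix_power M j"
      by (auto simp: inj_on_def)
    define c :: "nat \<Rightarrow> real" where "c l = (if l = i then 1 else if l = j then -1 else 0)" for l
    have "(\<Sum>l\<le>N. c l *\<^sub>R matrix_power M l)
        = (\<Sum>l\<le>N. (if l = i then matrix_power M l else 0) - (if l = j then matrix_power M l else 0))"
      using ij(3) by (intro sum.cong) (auto simp: c_def)
    also have "\<dots> = 0"
      using ij by (simp add: sum_subtractf)
    finally show ?thesis
      using ij by (intro exI[of _ c]) (auto simp: c_def)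
  qed
  then obtain c :: "nat \<Rightarrow> real" and i where c: "i \<le> N" "c i \<noteq> 0"
      "(\<Sum>i\<le>N. c i *\<^sub>R matrix_power M i) = 0" by blast
  define p where "p = (\<Sum>i\<le>N. monom (complex_of_real (c i)) i)"
  have "coeff p i = complex_of_real (c i)"
    using c(1) by (simp add: p_def coeff_sum if_distrib cong: if_cong)
  then have "p \<noteq> 0"
    using c(2) by auto
  moreover have "mat (complex_of_real a) ** P = a *\<^sub>R P" for a and P :: "complex ^ 'n ^ 'n"
    by (simp add: mat_matrix_mult vec_eq_iff) (simp add: scaleR_conv_of_real)
  then have "matrix_poly p M = 0"
    using c(3) by (simp add: p_def matrix_poly_sum matrix_poly_monom)
  ultimately show ?thesis
    using that by blast
qed

section \<open>Stability of linear differential equations\<close>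

text \<open>
  A Gronwall argument: once \<open>k \<le> a \<epsilon>\<close>, the excess \<open>h - \<epsilon>\<close> satisfies \<open>(h - \<epsilon>)' \<le> - a (h - \<epsilon>)\<close>, so
  \<open>exp (a t) (h - \<epsilon>)\<close> is nonincreasing and \<open>h\<close> eventually falls below \<open>2 \<epsilon>\<close>.
\<close>

lemma damped_inequality_tendsto_0:
  fixes h d k :: "real \<Rightarrow> real"
  assumes deriv: "\<And>t. t > 0 \<Longrightarrow> (h has_real_derivative d t) (at t)"
    and ineq: "\<And>t. t > 0 \<Longrightarrow> d t \<le> - a * h t + k t"
    and "a > 0" and nonneg: "\<And>t. h t \<ge> 0"
    and k: "(k \<longlongrightarrow> 0) at_top"
  shows "(h \<longlongrightarrow> 0) at_top"
proof (rule tendstoI)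
  fix e :: real assume "e > 0"
  define \<epsilon> where "\<epsilon> = e / 2"
  have "\<epsilon> > 0" using \<open>e > 0\<close> by (simp add: \<epsilon>_def)
  have "eventually (\<lambda>t. k t < a * \<epsilon> \<and> t > 0) at_top"
    using order_tendstoD(2)[OF k, of "a * \<epsilon>"] \<open>a > 0\<close> \<open>\<epsilon> > 0\<close>
    by (intro eventually_conj eventually_gt_at_top) simp
  then obtain t0 where t0: "\<And>t. t \<ge> t0 \<Longrightarrow> k t < a * \<epsilon> \<and> t > 0"
    by (auto simp: eventually_at_top_linorder)
  define g where "g t = exp (a * t) * (h t - \<epsilon>)" for t
  have decr: "g t \<le> g t0" if "t \<ge> t0" for t
  proof (rule DERIV_nonpos_imp_nonincreasing[OF that])
    fix s assume s: "t0 \<le> s" "s \<le> t"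
    have "(g has_real_derivative exp (a * s) * (a * (h s - \<epsilon>) + d s)) (at s)"
      unfolding g_def using t0[OF s(1)]
      by (auto intro!: derivative_eq_intros deriv simp: algebra_simps)
    moreover have "a * (h s - \<epsilon>) + d s \<le> 0"
      using ineq[of s] t0[OF s(1)] by (simp add: algebra_simps)
    ultimately show "\<exists>y. (g has_real_derivative y) (at s) \<and> y \<le> 0"
      by (meson exp_ge_zero mult_nonneg_nonpos)
  qed
  have "((\<lambda>t. g t0 * exp (- (a * t))) \<longlongrightarrow> 0) at_top"
    using \<open>a > 0\<close>
    by (intro tendsto_mult_right_zero filterlim_compose[OF exp_at_bot])
      (simp add: filterlim_uminus_at_bot
        filterlim_tendsto_pos_mult_at_top[OF tendsto_const _ filterlim_ident])
  then have "eventually (\<lambda>t. g t0 * exp (- (a * t)) < \<epsilon>) at_top"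
    using \<open>\<epsilon> > 0\<close> by (rule order_tendstoD)
  then show "eventually (\<lambda>t. dist (h t) 0 < e) at_top"
    using eventually_ge_at_top[of t0]
  proof eventually_elim
    case (elim t)
    have "h t - \<epsilon> = g t * exp (- (a * t))"
      by (simp add: g_def exp_minus)
    also have "\<dots> \<le> g t0 * exp (- (a * t))"
      using decr elim by (intro mult_right_mono) auto
    finally show ?case
      using elim nonneg[of t] by (simp add: \<epsilon>_def)
  qed
qed

lemma inner_scale_complex: "inner v (l *s v) = Re l * (norm v)\<^sup>2" for v :: "complex ^ 'n"
proof -
  have "inner z (l * z) = Re l * inner z z" for z
    by (simp add: inner_complex_def algebra_simps)
  then show ?thesis
    by (simp add: power2_norm_eq_inner inner_vec_def sum_distrib_left)
qed

text \<open>
  With \<open>a = - Re l\<close> the energy \<open>norm (w t)\<^sup>2\<close> has derivative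
  \<open>- 2 a norm (w t)\<^sup>2 + 2 w t \<bullet> g t\<close>. Half of the damping absorbs the mixed term by Young's inequality,
  leaving the forcing \<open>norm (g t)\<^sup>2 / a\<close>, which tends to \<open>0\<close>.
\<close>

lemma forced_decay_tendsto_0:
  fixes w g :: "real \<Rightarrow> complex ^ 'n"
  assumes ode: "\<And>t. t > 0 \<Longrightarrow> (w has_vector_derivative (l *s w t + g t)) (at t)"
    and "Re l < 0" and g: "(g \<longlongrightarrow> 0) at_top"
  shows "(w \<longlongrightarrow> 0) at_top"
proof -
  define a where "a = - Re l"
  have "a > 0" using \<open>Re l < 0\<close> by (simp add: a_def)
  have "((\<lambda>t. inner (w t) (w t)) \<longlongrightarrow> 0) at_top"
  proof (rule damped_inequality_tendsto_0)
    fix t :: real assume "t > 0"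
    from ode[OF this] show "((\<lambda>t. inner (w t) (w t)) has_real_derivative
        2 * inner (w t) (l *s w t + g t)) (at t)"
      unfolding has_vector_derivative_def has_field_derivative_def
      by (auto intro!: derivative_eq_intros simp: inner_commute algebra_simps inner_add_left inner_add_right)
    have "0 \<le> (a * norm (w t) - norm (g t))\<^sup>2 / a"
      using \<open>a > 0\<close> by simp
    also have "\<dots> = a * (norm (w t))\<^sup>2 - 2 * (norm (w t) * norm (g t)) + (norm (g t))\<^sup>2 / a"
      using \<open>a > 0\<close> by (simp add: power2_eq_square field_simps)
    finally have "2 * (norm (w t) * norm (g t)) \<le> a * (norm (w t))\<^sup>2 + (norm (g t))\<^sup>2 / a"
      by simp
    moreover have "inner (w t) (g t) \<le> norm (w t) * norm (g t)"
      by (rule norm_cauchy_schwarz)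
    ultimately show "2 * inner (w t) (l *s w t + g t)
        \<le> - a * inner (w t) (w t) + (norm (g t))\<^sup>2 / a"
      by (simp add: inner_add_right inner_scale_complex a_def flip: power2_norm_eq_inner)
  next
    show "((\<lambda>t. (norm (g t))\<^sup>2 / a) \<longlongrightarrow> 0) at_top"
      using tendsto_divide[OF tendsto_power[OF tendsto_norm[OF g], of 2] tendsto_const[of a]] \<open>a > 0\<close>
      by simp
  qed (use \<open>a > 0\<close> in auto)
  then have "((\<lambda>t. sqrt (inner (w t) (w t))) \<longlongrightarrow> 0) at_top"
    using tendsto_real_sqrt by fastforce
  then show ?thesis
    by (simp add: tendsto_norm_zero_iff flip: norm_eq_sqrt_inner)
qed

text \<open>
  Induction on the degree of \<open>p\<close>, for all solutions at once. A linear factor \<open>X - l\<close> of \<open>p\<close> is moved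
  from the polynomial to the solution; as \<open>M - l\<close> commutes with \<open>M\<close>, the result solves the same equation. The
  roots of \<open>p\<close> need not be eigenvalues; at those that are not, \<open>M - l\<close> is inverted instead.
\<close>

lemma annihilated_solution_tendsto_0:
  fixes M :: "complex ^ 'n ^ 'n" and w :: "real \<Rightarrow> complex ^ 'n"
  assumes stable: "\<And>l v. v \<noteq> 0 \<Longrightarrow> M *v v = l *s v \<Longrightarrow> Re l < 0"
    and "p \<noteq> 0"
    and "\<And>t. t > 0 \<Longrightarrow> (w has_vector_derivative (M *v w t)) (at t)"
    and "\<And>t. t > 0 \<Longrightarrow> matrix_poly p M *v w t = 0"
  shows "(w \<longlongrightarrow> 0) at_top"
  using assms(2-4)
proof (induction "degree p" arbitrary: p w)
  case 0
  then obtain c where "p = [:c:]" "c \<noteq> 0"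
    by (metis degree_eq_zeroE pCons_eq_0_iff)
  then have "w t = 0" if "t > 0" for t
    using 0(4)[OF that] by (simp add: mat_vector_mult)
  then have "eventually (\<lambda>t. w t = 0) at_top"
    using eventually_at_top_dense by blast
  then show ?case
    by (rule tendsto_eventually)
next
  case (Suc d)
  obtain l where "poly p l = 0"
    using fundamental_theorem_of_algebra_alt[of p] Suc.hyps(2) by (metis Zero_not_Suc degree_pCons_0)
  then obtain q where q: "p = [:- l, 1:] * q"
    by (auto simp: poly_eq_0_iff_dvd)
  have "q \<noteq> 0" using q Suc.prems(1) by auto
  have "degree q = d"
    using Suc.hyps(2) q \<open>q \<noteq> 0\<close> by (simp add: degree_mult_eq del: mult_pCons_left)
  define g where "g t = (M - mat l) *v w t" for t
  have g_eq: "g t = M *v w t - l *s w t" for t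
    by (simp add: g_def mat_vector_mult matrix_vector_mult_diff_rdistrib)
  have factor: "matrix_poly [:- l, 1:] M = M - mat l"
    by simp (simp add: mat_def vec_eq_iff)
  have g: "(g \<longlongrightarrow> 0) at_top"
  proof (rule Suc.hyps(1)[of q])
    show "d = degree q" using \<open>degree q = d\<close> by simp
    fix t :: real assume "t > 0"
    have "(g has_vector_derivative (M - mat l) *v (M *v w t)) (at t)"
      unfolding g_def
      by (rule bounded_linear.has_vector_derivative[OF matrix_vector_mul_bounded_linear Suc.prems(2)[OF \<open>t > 0\<close>]])
    moreover have "(M - mat l) *v (M *v w t) = M *v g t"
      by (simp add: g_eq matrix_vector_mult_diff_rdistrib matrix_vector_mult_diff_distrib
          mat_vector_mult vec.scale)
    ultimately show "(g has_vector_derivative M *v g t) (at t)" by simp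
    have "matrix_poly q M *v g t = matrix_poly (q * [:- l, 1:]) M *v w t"
      by (simp only: g_def matrix_vector_mul_assoc matrix_poly_mult factor)
    then show "matrix_poly q M *v g t = 0"
      using Suc.prems(3)[OF \<open>t > 0\<close>] by (simp only: q mult.commute)
  qed fact
  show ?case
  proof (cases "\<exists>v. v \<noteq> 0 \<and> M *v v = l *s v")
    case True
    then have "Re l < 0" using stable by blast
    then show ?thesis
      using g Suc.prems(2) by (intro forced_decay_tendsto_0[of w l g]) (simp_all add: g_eq)
  next
    case False
    then have "\<forall>v. (M - mat l) *v v = 0 \<longrightarrow> v = 0"
      by (auto simp: matrix_vector_mult_diff_rdistrib mat_vector_mult)
    then obtain N where N: "N ** (M - mat l) = mat 1"
      using matrix_left_invertible_ker by blast
    have "w = (\<lambda>t. N *v g t)"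
      by (simp add: g_def matrix_vector_mul_assoc N)
    moreover have "((\<lambda>t. N *v g t) \<longlongrightarrow> N *v 0) at_top"
      by (rule bounded_linear.tendsto[OF matrix_vector_mul_bounded_linear g])
    ultimately show ?thesis by simp
  qed
qed

definition complexify :: "real ^ 'n \<Rightarrow> complex ^ 'n" where
  "complexify v = (\<chi> i. complex_of_real (v $ i))"

lemma bounded_linear_complexify: "bounded_linear (complexify :: real ^ 'n \<Rightarrow> complex ^ 'n)"
  unfolding linear_conv_bounded_linear[symmetric]
proof (rule linearI)
  show "complexify (c *\<^sub>R v) = c *\<^sub>R complexify v" for c and v :: "real ^ 'n"
    by (simp add: complexify_def vec_eq_iff) (simp add: scaleR_conv_of_real)
qed (simp add: complexify_def vec_eq_iff)

lemma complexify_eq_0_iff [simp]: "complexify v = 0 \<longleftrightarrow> v = 0"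
  by (simp add: complexify_def vec_eq_iff)

lemma complexify_matrix_vector_mult:
  "complexify (M *v v) = map_matrix complex_of_real M *v complexify v"
  by (simp add: complexify_def vec_eq_iff matrix_vector_mult_def map_matrix_def)

lemma hurwitz_solution_tendsto_0:
  fixes M :: "real ^ 'n ^ 'n" and e :: "real \<Rightarrow> real ^ 'n"
  assumes "hurwitz M" and ode: "\<And>t. t > 0 \<Longrightarrow> (e has_vector_derivative (M *v e t)) (at t)"
  shows "(e \<longlongrightarrow> 0) at_top"
proof -
  let ?M = "map_matrix complex_of_real M"
  obtain p where p: "p \<noteq> 0" "matrix_poly p ?M = 0"
    by (rule exists_annihilating_poly)
  have "((\<lambda>t. complexify (e t)) \<longlongrightarrow> 0) at_top"
  proof (rule annihilated_solution_tendsto_0[OF _ p(1)])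
    show "Re l < 0" if "v \<noteq> 0" "?M *v v = l *s v" for l v
      using \<open>hurwitz M\<close> that by (auto simp: hurwitz_def complex_eigenvalue_def)
    show "((\<lambda>t. complexify (e t)) has_vector_derivative ?M *v complexify (e t)) (at t)" if "t > 0" for t
      using bounded_linear.has_vector_derivative[OF bounded_linear_complexify ode[OF that]]
      by (simp add: complexify_matrix_vector_mult)
  qed (simp add: p(2))
  then have "((\<lambda>t. Re (complexify (e t) $ i)) \<longlongrightarrow> Re ((0 :: complex ^ 'n) $ i)) at_top" for i
    by (intro tendsto_Re tendsto_vec_nth)
  then show ?thesis
    by (intro vec_tendstoI) (simp add: complexify_def)
qed

lemma hurwitz_imp_invertible:
  fixes M :: "real ^ 'n ^ 'n"
  assumes "hurwitz M"
  shows "invertible M"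
proof -
  have "v = 0" if "M *v v = 0" for v
  proof (rule ccontr)
    assume "v \<noteq> 0"
    moreover have "map_matrix complex_of_real M *v complexify v = 0 *s complexify v"
      by (metis that complexify_matrix_vector_mult complexify_eq_0_iff vector_smult_lzero)
    ultimately have "complex_eigenvalue M 0"
      unfolding complex_eigenvalue_def by (metis complexify_eq_0_iff)
    then show False using assms by (auto simp: hurwitz_def)
  qed
  then show ?thesis
    by (simp add: invertible_left_inverse matrix_left_invertible_ker)
qed

section \<open>The closed-loop equilibrium and tracking\<close>

lemma sum_UNIV_Plus: "(\<Sum>i\<in>UNIV. f i) = (\<Sum>a\<in>UNIV. f (Inl a)) + (\<Sum>b\<in>UNIV. f (Inr b))"
  for f :: "'m::finite + 'p::finite \<Rightarrow> 'b::comm_monoid_add"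
  using sum.Plus[of UNIV UNIV f] by (simp add: comp_def)

lemma stack_matrix_vector_mult: "stack P Q *v v = stack (P *v v) (Q *v v)"
  by (auto simp: stack_def matrix_vector_mult_def vec_eq_iff split: sum.split)

lemma beside_mult_stack: "beside P Q *v stack v w = P *v v + Q *v w"
  by (simp add: beside_def stack_def matrix_vector_mult_def vec_eq_iff sum_UNIV_Plus)

lemma stack_add: "stack v w + stack v' w' = stack (v + v') (w + w')"
  by (auto simp: stack_def vec_eq_iff split: sum.split)

lemma stack_eq_iff: "stack v w = stack v' w' \<longleftrightarrow> v = v' \<and> w = w'"
proof
  assume eq: "stack v w = stack v' w'"
  have "v $ a = v' $ a" "w $ b = w' $ b" for a b
    using arg_cong[OF eq, of "\<lambda>z. z $ Inl a"] arg_cong[OF eq, of "\<lambda>z. z $ Inr b"]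
    by (simp_all add: stack_def)
  then show "v = v' \<and> w = w'" by (simp add: vec_eq_iff)
qed simp

lemma stack_cases: obtains v w where "z = stack v w"
proof
  show "z = stack (\<chi> a. z $ Inl a) (\<chi> b. z $ Inr b)"
    by (auto simp: stack_def vec_eq_iff split: sum.split)
qed

text \<open>
  The block form of the closed loop unfolded into the plant \<open>x' = A x + B u\<close> and the controller
  \<open>u' = \<Psi> (r - C e\<^sup>A\<^sup>T x) - u\<close>.
\<close>

lemma closed_loop_field:
  "Phi A B C T *v stack x u + stack 0 (Psi A B C T) *v r
    = stack (A *v x + B *v u)
        (Psi A B C T *v (r - C *v (matrix_exp (T *\<^sub>R A) *v x)) - u)"
  unfolding Phi_def block_matrix_def stack_matrix_vector_mult beside_mult_stack stack_add stack_eq_iff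
  by (simp add: matrix_vector_mul_assoc matrix_vector_mult_diff_distrib
      matrix_vector_mult_diff_rdistrib matrix_mul_assoc flip: diff_0)

text \<open>
  Here \<open>G\<close>, the inverse of the gain \<open>\<Psi>\<close>, is evaluated at the steady input in two ways: by the
  controller equation, and by eliminating the input with the plant equation once \<open>A\<inverse>\<close> has been
  moved past \<open>e\<^sup>A\<^sup>T - I\<close>.
\<close>

lemma closed_loop_equilibrium_output:
  fixes A :: "real ^ 'n ^ 'n" and B :: "real ^ 'k ^ 'n" and C :: "real ^ 'n ^ 'k"
  assumes "invertible A"
    and inv: "invertible (C ** matrix_inv A ** (matrix_exp (T *\<^sub>R A) - mat 1) ** B)"
    and eq: "Phi A B C T *v stack x u + stack 0 (Psi A B C T) *v r = 0"
  shows "C *v x = r"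
proof -
  define E where "E = matrix_exp (T *\<^sub>R A)"
  define G where "G = C ** matrix_inv A ** (E - mat 1) ** B"
  have zero: "(0 :: real ^ ('n + 'k)) = stack 0 0"
    by (auto simp: stack_def vec_eq_iff split: sum.split)
  have plant: "A *v x + B *v u = 0" and control: "u = Psi A B C T *v (r - C *v (E *v x))"
    using eq unfolding closed_loop_field zero stack_eq_iff by (simp_all add: E_def)
  have "G ** Psi A B C T = mat 1"
    using inv by (simp add: G_def E_def Psi_def matrix_inv_right)
  then have G_u: "G *v u = r - C *v (E *v x)"
    by (simp add: control matrix_vector_mul_assoc[of G])
  have "A ** (T *\<^sub>R A) = T *\<^sub>R A ** A"
    by (simp add: matrix_scalar_ac scalar_matrix_assoc)
  then have "A ** E = E ** A"
    unfolding E_def by (rule matrix_exp_commute)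
  then have "matrix_inv A ** E = E ** matrix_inv A"
    using \<open>invertible A\<close> by (rule matrix_inv_commute[rotated])
  then have comm: "matrix_inv A *v ((E - mat 1) *v v) = (E - mat 1) *v (matrix_inv A *v v)" for v
    by (simp only: matrix_vector_mult_diff_distrib matrix_vector_mult_diff_rdistrib
        matrix_vector_mul_assoc[of "matrix_inv A" E] matrix_vector_mul_lid
        matrix_vector_mul_assoc[of E "matrix_inv A"])
  have "B *v u = A *v (- x)"
    using plant by (simp add: eq_neg_iff_add_eq_0 add.commute vec.neg)
  then have "matrix_inv A *v (B *v u) = matrix_inv A *v (A *v (- x))" by simp
  also have "\<dots> = - x"
    using \<open>invertible A\<close> by (simp add: matrix_vector_mul_assoc matrix_inv_left)
  finally have "matrix_inv A *v (B *v u) = - x" .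
  then have "G *v u = C *v ((E - mat 1) *v (- x))"
    by (simp add: G_def comm flip: matrix_vector_mul_assoc)
  then have "G *v u = C *v x - C *v (E *v x)"
    by (simp add: matrix_vector_mult_diff_rdistrib vec.neg vec.diff)
  with G_u show ?thesis by simp
qed

theorem lemma2:
  fixes A :: "real ^ 'n ^ 'n"
    and B :: "real ^ 'k ^ 'n"
    and C :: "real ^ 'n ^ 'k"
    and T :: real
    and r :: "real ^ 'k"
    and x :: "real \<Rightarrow> real ^ 'n"
    and u :: "real \<Rightarrow> real ^ 'k"
    and y :: "real \<Rightarrow> real ^ 'k"
  assumes "invertible A"
    and "T > 0"
    and "invertible (C ** matrix_inv A ** (matrix_exp (T *\<^sub>R A) - mat 1) ** B)"
    and "\<And>t. t \<ge> 0 \<Longrightarrow>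
      ((\<lambda>s. stack (x s) (u s)) has_vector_derivative
        (Phi A B C T *v stack (x t) (u t) + stack 0 (Psi A B C T) *v r)) (at t within {0..})"
    and "\<And>t. t \<ge> 0 \<Longrightarrow> y t = C *v x t"
    and "hurwitz (Phi A B C T)"
  shows "(y \<longlongrightarrow> r) at_top"
proof -
  let ?\<Phi> = "Phi A B C T" and ?f = "stack 0 (Psi A B C T) *v r"
  obtain z where z: "?\<Phi> *v z = - ?f"
    using hurwitz_imp_invertible[OF assms(6)]
    by (metis invertible_def matrix_vector_mul_assoc matrix_vector_mul_lid)
  obtain x' u' where z_eq: "z = stack x' u'"
    by (rule stack_cases)
  have "C *v x' = r"
    using z by (intro closed_loop_equilibrium_output[OF assms(1,3), of x' u']) (simp add: z_eq)
  have "((\<lambda>t. stack (x t) (u t) - z) \<longlongrightarrow> 0) at_top"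
  proof (rule hurwitz_solution_tendsto_0[OF assms(6)])
    fix t :: real assume "t > 0"
    then have "at t within {0..} = at t"
      by (intro at_within_interior) (simp add: interior_real_atLeast)
    then have "((\<lambda>s. stack (x s) (u s) - z) has_vector_derivative
        (?\<Phi> *v stack (x t) (u t) + ?f - 0)) (at t)"
      using assms(4)[of t] \<open>t > 0\<close> by (intro derivative_intros) simp
    then show "((\<lambda>s. stack (x s) (u s) - z) has_vector_derivative
        ?\<Phi> *v (stack (x t) (u t) - z)) (at t)"
      by (simp add: matrix_vector_mult_diff_distrib z)
  qed
  then have "((\<lambda>t. stack (x t) (u t)) \<longlongrightarrow> z) at_top"
    by (simp add: Lim_null[symmetric])
  then have "((\<lambda>t. stack (x t) (u t) $ Inl i) \<longlongrightarrow> z $ Inl i) at_top" for i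
    by (rule tendsto_vec_nth)
  then have "(x \<longlongrightarrow> x') at_top"
    by (intro vec_tendstoI) (simp add: z_eq stack_def)
  then have "((\<lambda>t. C *v x t) \<longlongrightarrow> r) at_top"
    using bounded_linear.tendsto[OF matrix_vector_mul_bounded_linear] \<open>C *v x' = r\<close> by metis
  moreover have "eventually (\<lambda>t. C *v x t = y t) at_top"
    using assms(5) unfolding eventually_at_top_linorder by metis
  ultimately show ?thesis
    by (rule Lim_transform_eventually)
qed

end
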